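(* Let $(H,d)$ be a Hadamard space, let $\mu\in H$, and let $(X_k)_{k\ge1}$ and $(Y_k)_{k\ge1}$ be two sequences of random variables in $\mathcal{L}^2(H)$ on a common probability space. For each $n\ge1$ let $1\le r_n\le n$ be an integer and let $f=f_n$ be drawn uniformly from $$\mathcal{F}=\mathcal{F}_n=\{f:\{1,\dots,n\}\to\{0,1\}\ :\ |f^{-1}(1)|=r_n\},$$ independently of $\{X_1,\dots,X_n,Y_1,\dots,Y_n\}$. For $1\le k\le n$ let $Z_k=Z_k^{(n)}$ be given by $Z_k=X_k$ if $f(k)=0$ and $Z_k=Y_k$ if $f(k)=1$. Suppose that $$\frac{r_n}{n^2}\sum_{k=1}^n\mathbb{E}\bigl(d(X_k,Y_k)^2\bigr)\to0\quad(n\to\infty).$$ (i) If the inductive mean of $X_1,\dots,X_n$ converges to $\mu$ in $\mathcal{L}^2(H)$, then the inductive mean $S_n^Z$ of $Z_1,\dots,Z_n$ converges to $\mu$ in $\mathcal{L}^2(H)$. (ii) If the Fréchet mean of $X_1,\dots,X_n$ converges to $\mu$ in $\mathcal{L}^2(H)$, and both $\mathbb{E}(\max_{1\le k\le n}d(X_k,a)^2)$ and $\mathbb{E}(\max_{1\le k\le n}d(Y_k,a)^2)$ are $o(n)$ for some (and hence all) $a\in H$, then the Fréchet mean of $Z_1,\dots,Z_n$ converges to $\mu$ in $\mathcal{L}^2(H)$.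
   Context: A Hadamard space is a complete metric space $(H,d)$ such that for all $x,y\in H$ there is $m\in H$ with $d(z,m)^2\le\frac12 d(z,x)^2+\frac12 d(z,y)^2-\frac14 d(x,y)^2$ for all $z\in H$. Any two points $x,y\in H$ are joined by a unique minimal geodesic, i.e. a map $\gamma:[0,1]\to H$ with $\gamma(0)=x$, $\gamma(1)=y$, $d(\gamma(s),\gamma(t))=|t-s|\,d(x,y)$; write $x\oplus_t y=\gamma(t)$. The inductive mean of $x_1,\dots,x_n$ is $S_n$, where $S_1=x_1$, $S_{k+1}=S_k\oplus_{\frac1{k+1}}x_{k+1}$. The Fréchet mean of $x_1,\dots,x_n\in H$ is the unique minimizer of $z\mapsto\frac1n\sum_{k=1}^n d(x_k,z)^2$ over $H$. Both are applied pointwise to random variables. A random variable in $H$ is a Borel measurable map from a probability space to $H$; $X\in\mathcal{L}^2(H)$ means $\mathbb{E}(d(X,z)^2)<\infty$ for some (equivalently all) $z\in H$. $Z_n\to Z$ in $\mathcal{L}^2(H)$ means $\mathbb{E}(d(Z_n,Z)^2)\to0$. $|A|$ denotes the cardinality of a set $A$. *)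

theory Defs
  imports "HOL-Probability.Probability"
begin

class hadamard_space = complete_space +
  assumes hadamard_midpoint:
    "\<exists>m. \<forall>z. (dist z m)\<^sup>2 \<le> (dist z x)\<^sup>2 / 2 + (dist z y)\<^sup>2 / 2 - (dist x y)\<^sup>2 / 4"

definition minimal_geodesic :: "(real \<Rightarrow> 'a::metric_space) \<Rightarrow> 'a \<Rightarrow> 'a \<Rightarrow> bool" where
  "minimal_geodesic \<gamma> x y \<longleftrightarrow> \<gamma> 0 = x \<and> \<gamma> 1 = y \<and>
     (\<forall>s\<in>{0..1}. \<forall>t\<in>{0..1}. dist (\<gamma> s) (\<gamma> t) = \<bar>t - s\<bar> * dist x y)"

(* The point is described instead of the path, because a geodesic is determined
   only on the unit interval.  The value is meaningful for 0 <= t <= 1. *)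
definition geodesic_point :: "'a::hadamard_space \<Rightarrow> real \<Rightarrow> 'a \<Rightarrow> 'a" where
  "geodesic_point x t y = (THE p. \<exists>\<gamma>. minimal_geodesic \<gamma> x y \<and> \<gamma> t = p)"

(* Sequences are indexed from 1; the means are meaningful for n >= 1. *)
fun inductive_mean :: "(nat \<Rightarrow> 'a::hadamard_space) \<Rightarrow> nat \<Rightarrow> 'a" where
  "inductive_mean x 0 = undefined"
| "inductive_mean x (Suc 0) = x 1"
| "inductive_mean x (Suc (Suc k)) =
     geodesic_point (inductive_mean x (Suc k)) (1 / real (Suc (Suc k))) (x (Suc (Suc k)))"

definition frechet_mean :: "(nat \<Rightarrow> 'a::hadamard_space) \<Rightarrow> nat \<Rightarrow> 'a" where
  "frechet_mean x n =
     (THE z. is_arg_min (\<lambda>w. 1 / real n * (\<Sum>k=1..n. (dist (x k) w)\<^sup>2)) (\<lambda>_. True) z)"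

definition in_L2 :: "'b measure \<Rightarrow> ('b \<Rightarrow> 'a::hadamard_space) \<Rightarrow> bool" where
  "in_L2 M X \<longleftrightarrow> X \<in> borel_measurable M \<and> (\<exists>z. integrable M (\<lambda>\<omega>. (dist (X \<omega>) z)\<^sup>2))"

(* If the space is not separable, the distance between two Borel measurable maps need
   not be measurable (nor need the means of such maps be).  The expectation of such a
   nonnegative function is therefore taken to be its upper integral; nn_integral would
   be the lower one.  On measurable functions both are the usual expectation. *)
definition upper_expectation :: "'b measure \<Rightarrow> ('b \<Rightarrow> ennreal) \<Rightarrow> ennreal" where
  "upper_expectation M V =
     (INF g \<in> {g \<in> borel_measurable M. \<forall>\<omega>\<in>space M. V \<omega> \<le> g \<omega>}. \<integral>\<^sup>+\<omega>. g \<omega> \<partial>M)"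

lemma upper_expectation_eq_nn_integral:
  assumes "V \<in> borel_measurable M"
  shows "upper_expectation M V = (\<integral>\<^sup>+\<omega>. V \<omega> \<partial>M)"
  unfolding upper_expectation_def
  by (rule antisym) (auto intro!: INF_lower INF_greatest nn_integral_mono assms)

lemma upper_expectation_eq_expectation:
  fixes V :: "'b \<Rightarrow> real"
  assumes "integrable M V" and "\<And>\<omega>. 0 \<le> V \<omega>"
  shows "upper_expectation M (\<lambda>\<omega>. ennreal (V \<omega>)) = ennreal (\<integral>\<omega>. V \<omega> \<partial>M)"
  using assms by (simp add: upper_expectation_eq_nn_integral nn_integral_eq_integral)

definition tendsto_L2 :: "'b measure \<Rightarrow> (nat \<Rightarrow> 'b \<Rightarrow> 'a::hadamard_space) \<Rightarrow> ('b \<Rightarrow> 'a) \<Rightarrow> bool" where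
  "tendsto_L2 M W V \<longleftrightarrow>
     (\<lambda>n. upper_expectation M (\<lambda>\<omega>. ennreal ((dist (W n \<omega>) (V \<omega>))\<^sup>2))) \<longlonglongrightarrow> 0"

definition selectors :: "nat \<Rightarrow> nat \<Rightarrow> (nat \<Rightarrow> nat) set" where
  "selectors n r = {f \<in> {1..n} \<rightarrow>\<^sub>E {0, 1}. card {k \<in> {1..n}. f k = 1} = r}"

end

theory Submission
  imports Defs
begin

text \<open>
  Both means are \<^emph>\<open>contractive\<close>: replacing the data \<open>x\<^sub>1, \<dots>, x\<^sub>n\<close> by \<open>y\<^sub>1, \<dots>, y\<^sub>n\<close> moves the mean by
  at most the average of the distances \<open>dist (x k) (y k)\<close>
  (\<open>inductive_mean_contraction\<close>, \<open>frechet_mean_contraction\<close>). For every outcome the samples \<open>X\<close> and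
  \<open>Z\<close> differ in at most \<open>r\<^sub>n\<close> places, so the Cauchy--Schwarz inequality over these places bounds the
  squared distance between the two means by \<open>r\<^sub>n / n\<^sup>2\<close> times the full sum of the squared distances
  \<open>dist (X k) (Y k)\<close>. The expectation of this bound tends to zero by hypothesis, and
  \<open>(p + q)\<^sup>2 \<le> 2 p\<^sup>2 + 2 q\<^sup>2\<close> carries the convergence over from \<open>X\<close> to \<open>Z\<close>. This works in the same way for
  every contractive mean (\<open>tendsto_L2_contractive_mean\<close>), and thus gives both parts at once.

  The contraction property rests on one geometric notion. A barycenter of weighted points is a minimizer
  \<open>b\<close> of the weighted sum \<open>F\<close> of squared distances; in a Hadamard space it satisfies the variance
  inequality \<open>F b + (dist z b)\<^sup>2 \<le> F z\<close>. Points on geodesics are barycenters of their two end points,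
  so the same comparison of barycenters (\<open>barycenter_contraction\<close>) handles the Frechet mean
  directly and the inductive mean step by step. The comparison itself is obtained by adding the variance
  inequalities of the two barycenters, each tested at the other one, and estimating the mixed terms by
  the quadruple inequality \<open>quadruple_comparison\<close>.
\<close>

section \<open>Barycenters\<close>

lemma midpoint_exists:
  fixes x y :: "'a::hadamard_space"
  obtains m where "dist x m = dist x y / 2" and "dist y m = dist x y / 2"
    and "\<And>z. (dist z m)\<^sup>2 \<le> (dist z x)\<^sup>2 / 2 + (dist z y)\<^sup>2 / 2 - (dist x y)\<^sup>2 / 4"
proof -
  obtain m where m: "\<And>z. (dist z m)\<^sup>2 \<le> (dist z x)\<^sup>2 / 2 + (dist z y)\<^sup>2 / 2 - (dist x y)\<^sup>2 / 4"
    using hadamard_midpoint[of x y] by blast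
  have "(dist x m)\<^sup>2 \<le> (dist x y / 2)\<^sup>2" "(dist y m)\<^sup>2 \<le> (dist x y / 2)\<^sup>2"
    using m[of x] m[of y] by (simp_all add: power_divide dist_commute)
  then have "dist x m \<le> dist x y / 2" "dist y m \<le> dist x y / 2"
    by (auto intro: power2_le_imp_le)
  moreover have "dist x y \<le> dist x m + dist y m"
    by (metis dist_commute dist_triangle)
  ultimately have "dist x m = dist x y / 2" "dist y m = dist x y / 2" by linarith+
  then show thesis using m by (rule that)
qed

text \<open>
  Strong midpoint convexity makes every minimizing sequence Cauchy, so a minimizer \<open>b\<close> exists. The
  constant 1 in front of \<open>(dist z b)\<^sup>2\<close> is found by bootstrapping: if growth with constant \<open>c\<close> is known,
  then testing it at the midpoint of \<open>b\<close> and \<open>z\<close> gives growth with constant \<open>(1 + c) / 2\<close>, and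
  these constants tend to 1.
\<close>

lemma strongly_midpoint_convex_minimizer:
  fixes F :: "'a::complete_space \<Rightarrow> real"
  assumes cont: "continuous_on UNIV F" and nonneg: "\<And>z. 0 \<le> F z"
    and mid: "\<And>y z. \<exists>m. dist y m = dist y z / 2 \<and>
                   F m \<le> F y / 2 + F z / 2 - (dist y z)\<^sup>2 / 4"
  shows "\<exists>b. \<forall>z. F b + (dist z b)\<^sup>2 \<le> F z"
proof -
  define I where "I = Inf (range F)"
  have bdd: "bdd_below (range F)" using nonneg by (auto intro: bdd_belowI[of _ 0])
  have I_le: "I \<le> F z" for z unfolding I_def by (rule cInf_lower[OF _ bdd]) auto
  have "\<exists>z. F z < I + 1 / real (Suc n)" for n
  proof -
    have "Inf (range F) < I + 1 / real (Suc n)" unfolding I_def by simp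
    then show ?thesis using bdd by (subst (asm) cInf_less_iff) auto
  qed
  then obtain u where u: "\<And>n. F (u n) < I + 1 / real (Suc n)" by metis
  have "Cauchy u"
  proof (rule metric_CauchyI)
    fix e :: real assume e: "0 < e"
    then obtain N where N: "1 / real (Suc N) < e\<^sup>2 / 4"
      using reals_Archimedean[of "e\<^sup>2 / 4"] by (auto simp: inverse_eq_divide)
    have close: "F (u n) < I + e\<^sup>2 / 4" if "N \<le> n" for n
    proof -
      have "1 / real (Suc n) \<le> 1 / real (Suc N)" using that by (simp add: frac_le)
      then show ?thesis using u[of n] N by linarith
    qed
    have "dist (u m) (u n) < e" if "N \<le> m" "N \<le> n" for m n
    proof -
      obtain p where "F p \<le> F (u m) / 2 + F (u n) / 2 - (dist (u m) (u n))\<^sup>2 / 4"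
        using mid by blast
      then have "(dist (u m) (u n))\<^sup>2 < e\<^sup>2"
        using close[OF that(1)] close[OF that(2)] I_le[of p] by linarith
      then show ?thesis using e by (simp add: power2_less_imp_less)
    qed
    then show "\<exists>N. \<forall>m\<ge>N. \<forall>n\<ge>N. dist (u m) (u n) < e" by blast
  qed
  then obtain b where b: "u \<longlonglongrightarrow> b" using Cauchy_convergent convergent_def by blast
  have "(\<lambda>n. F (u n)) \<longlonglongrightarrow> F b"
    using cont b by (rule continuous_on_tendsto_compose) auto
  moreover have "(\<lambda>n. I + 1 / real (Suc n)) \<longlonglongrightarrow> I"
    using tendsto_add[OF tendsto_const LIMSEQ_inverse_real_of_nat, of I]
    by (simp add: inverse_eq_divide)
  ultimately have "F b \<le> I"
    by (rule LIMSEQ_le) (use u in \<open>auto intro: less_imp_le\<close>)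
  then have b_min: "F b \<le> F z" for z using I_le order_trans by blast
  \<comment> \<open>the constants produced by \<open>c \<mapsto> (1 + c) / 2\<close> from \<open>c = 0\<close>\<close>
  have growth: "F b + (1 - (1/2) ^ j) * (dist z b)\<^sup>2 \<le> F z" for j z
  proof (induction j arbitrary: z)
    case 0
    show ?case using b_min by simp
  next
    case (Suc j)
    obtain m where m: "dist b m = dist b z / 2"
      "F m \<le> F b / 2 + F z / 2 - (dist b z)\<^sup>2 / 4" using mid by blast
    define q :: real where "q = (1/2) ^ j"
    have "F b + (1 - q) * (dist b z / 2)\<^sup>2 \<le> F m"
      using Suc.IH[of m] m(1) by (simp only: q_def dist_commute[of m b])
    then have "F b + (dist b z)\<^sup>2 / 4 - q * (dist b z)\<^sup>2 / 4 \<le> F m"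
      by (simp only: power_divide) (simp add: left_diff_distrib diff_divide_distrib)
    then have "F b + (dist b z)\<^sup>2 - q * (dist b z)\<^sup>2 / 2 \<le> F z"
      using m(2) by linarith
    moreover have "(1 - (1/2) ^ Suc j) * (dist z b)\<^sup>2 = (dist b z)\<^sup>2 - q * (dist b z)\<^sup>2 / 2"
      by (simp only: q_def power_Suc dist_commute[of z b]) (simp add: left_diff_distrib diff_divide_distrib)
    ultimately show ?case by linarith
  qed
  have "F b + (dist z b)\<^sup>2 \<le> F z" for z
  proof -
    have "(\<lambda>j. F b + (1 - (1/2) ^ j) * (dist z b)\<^sup>2) \<longlonglongrightarrow> F b + (1 - 0) * (dist z b)\<^sup>2"
      by (intro tendsto_intros LIMSEQ_power_zero) auto
    then show ?thesis using growth by (intro LIMSEQ_le_const2) auto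
  qed
  then show ?thesis by blast
qed

text \<open>
  The defining inequality is the variance inequality and not mere minimality: comparison arguments use
  barycenters only through it, and it makes them unique.
\<close>

definition barycenter :: "'i set \<Rightarrow> ('i \<Rightarrow> real) \<Rightarrow> ('i \<Rightarrow> 'a::metric_space) \<Rightarrow> 'a \<Rightarrow> bool" where
  "barycenter I w x b \<longleftrightarrow>
     (\<forall>z. (\<Sum>i\<in>I. w i * (dist (x i) b)\<^sup>2) + (dist z b)\<^sup>2 \<le> (\<Sum>i\<in>I. w i * (dist (x i) z)\<^sup>2))"

lemma barycenter_exists:
  fixes x :: "'i \<Rightarrow> 'a::hadamard_space"
  assumes nonneg: "\<And>i. i \<in> I \<Longrightarrow> 0 \<le> w i" and total: "(\<Sum>i\<in>I. w i) = 1"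
  shows "\<exists>b. barycenter I w x b"
  unfolding barycenter_def
proof (rule strongly_midpoint_convex_minimizer)
  let ?F = "\<lambda>z::'a. \<Sum>i\<in>I. w i * (dist (x i) z)\<^sup>2"
  show "continuous_on UNIV ?F" by (intro continuous_intros)
  show "0 \<le> ?F z" for z using nonneg by (intro sum_nonneg) auto
  fix y z :: 'a
  obtain m where m: "dist y m = dist y z / 2"
    "\<And>p. (dist p m)\<^sup>2 \<le> (dist p y)\<^sup>2 / 2 + (dist p z)\<^sup>2 / 2 - (dist y z)\<^sup>2 / 4"
    using midpoint_exists[of y z] by metis
  have "?F m \<le> (\<Sum>i\<in>I. w i * ((dist (x i) y)\<^sup>2 / 2 + (dist (x i) z)\<^sup>2 / 2 - (dist y z)\<^sup>2 / 4))"
    using m(2) nonneg by (intro sum_mono mult_left_mono) auto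
  also have "\<dots> = ?F y / 2 + ?F z / 2 - (\<Sum>i\<in>I. w i) * ((dist y z)\<^sup>2 / 4)"
    by (simp add: algebra_simps sum.distrib sum_subtractf sum_distrib_left sum_distrib_right
        sum_divide_distrib)
  finally show "\<exists>m. dist y m = dist y z / 2 \<and> ?F m \<le> ?F y / 2 + ?F z / 2 - (dist y z)\<^sup>2 / 4"
    using m(1) total by auto
qed

lemma barycenter_unique_minimizer:
  assumes b: "barycenter I w x b"
    and c: "\<And>z. (\<Sum>i\<in>I. w i * (dist (x i) c)\<^sup>2) \<le> (\<Sum>i\<in>I. w i * (dist (x i) z)\<^sup>2)"
  shows "c = b"
proof -
  have "(dist c b)\<^sup>2 \<le> 0"
    using b[unfolded barycenter_def, rule_format, of c] c[of b] by linarith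
  then show ?thesis by simp
qed

lemma frechet_mean_barycenter:
  fixes x :: "nat \<Rightarrow> 'a::hadamard_space"
  assumes n: "1 \<le> n"
  shows "barycenter {1..n} (\<lambda>_. 1 / real n) x (frechet_mean x n)"
proof -
  obtain b where b: "barycenter {1..n} (\<lambda>_. 1 / real n) x b"
    using barycenter_exists[of "{1..n}" "\<lambda>_. 1 / real n" x] n by auto
  have "frechet_mean x n = b"
    unfolding frechet_mean_def sum_distrib_left
  proof (rule the_equality)
    show "is_arg_min (\<lambda>w. \<Sum>k=1..n. 1 / real n * (dist (x k) w)\<^sup>2) (\<lambda>_. True) b"
      using b by (auto simp: is_arg_min_linorder barycenter_def intro: order_trans[rotated])
  next
    fix z
    assume "is_arg_min (\<lambda>w. \<Sum>k=1..n. 1 / real n * (dist (x k) w)\<^sup>2) (\<lambda>_. True) z"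
    then show "z = b"
      by (intro barycenter_unique_minimizer[OF b]) (auto simp: is_arg_min_linorder)
  qed
  with b show ?thesis by simp
qed

section \<open>Geodesics as curves of two-point barycenters\<close>

text \<open>
  The last conjunct is the CN inequality of Bruhat and Tits with parameter \<open>t\<close>; at \<open>t = 1/2\<close> it is the
  axiom on midpoints.
\<close>

definition segment_point :: "'a::metric_space \<Rightarrow> real \<Rightarrow> 'a \<Rightarrow> 'a \<Rightarrow> bool" where
  "segment_point x t y p \<longleftrightarrow> dist x p = t * dist x y \<and> dist y p = (1 - t) * dist x y \<and>
     (\<forall>z. (dist z p)\<^sup>2 \<le> (1 - t) * (dist z x)\<^sup>2 + t * (dist z y)\<^sup>2 - t * (1 - t) * (dist x y)\<^sup>2)"

text \<open>
  Take the barycenter \<open>p\<close> of \<open>x\<close> and \<open>y\<close> with weights \<open>1 - t\<close> and \<open>t\<close>. By the triangle inequality, the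
  weighted sum of squared distances is at least \<open>t (1 - t) (dist x y)\<^sup>2\<close> at every point, hence at \<open>p\<close>, so
  the variance inequality becomes the CN inequality. The CN inequality at the end points then bounds both
  \<open>dist x p\<close> and \<open>dist y p\<close>, and the triangle inequality forces equality in both bounds.
\<close>

lemma segment_point_exists:
  fixes x y :: "'a::hadamard_space"
  assumes t: "t \<in> {0..1}"
  shows "\<exists>p. segment_point x t y p"
proof -
  have "\<exists>p. barycenter UNIV (\<lambda>i. if i then t else 1 - t) (\<lambda>i. if i then y else x) p"
    using t by (intro barycenter_exists) (simp_all add: UNIV_bool)
  then obtain p where "barycenter UNIV (\<lambda>i. if i then t else 1 - t) (\<lambda>i. if i then y else x) p"
    by blast
  note this[unfolded barycenter_def, rule_format]
  then have p: "(1 - t) * (dist x p)\<^sup>2 + t * (dist y p)\<^sup>2 + (dist z p)\<^sup>2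
      \<le> (1 - t) * (dist x z)\<^sup>2 + t * (dist y z)\<^sup>2" for z
    by (simp add: UNIV_bool add.commute)
  let ?a = "dist x p" and ?c = "dist y p" and ?L = "dist x y"
  have tri: "?L \<le> ?a + ?c" by (metis dist_commute dist_triangle)
  have "t * (1 - t) * ?L\<^sup>2 \<le> t * (1 - t) * (?a + ?c)\<^sup>2"
    using t tri by (intro mult_left_mono power_mono) auto
  also have "\<dots> = (1 - t) * ?a\<^sup>2 + t * ?c\<^sup>2 - ((1 - t) * ?a - t * ?c)\<^sup>2"
    by (simp add: power2_eq_square algebra_simps)
  also have "\<dots> \<le> (1 - t) * ?a\<^sup>2 + t * ?c\<^sup>2" by simp
  finally have cn: "(dist z p)\<^sup>2 \<le> (1 - t) * (dist z x)\<^sup>2 + t * (dist z y)\<^sup>2 - t * (1 - t) * ?L\<^sup>2" for z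
    using p[of z] by (simp add: dist_commute)
  have "?a\<^sup>2 \<le> (t * ?L)\<^sup>2" "?c\<^sup>2 \<le> ((1 - t) * ?L)\<^sup>2"
    using cn[of x] cn[of y] by (simp_all add: dist_commute power2_eq_square algebra_simps)
  then have "?a \<le> t * ?L" "?c \<le> (1 - t) * ?L"
    using t by (auto intro: power2_le_imp_le)
  then have "?a = t * ?L" "?c = (1 - t) * ?L"
    using tri by (simp_all add: algebra_simps)
  then show ?thesis using cn unfolding segment_point_def by blast
qed

text \<open>
  The segment points form a minimal geodesic, since the CN inequality at \<open>\<gamma> t\<close>, tested at \<open>\<gamma> s\<close>,
  gives exactly \<open>((t - s) dist x y)\<^sup>2\<close>. The same inequality, tested at the point with parameter \<open>t\<close> of any
  other minimal geodesic, shows that this point is at distance zero from \<open>\<gamma> t\<close>; so the definite description in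
  \<open>geodesic_point\<close> denotes \<open>\<gamma> t\<close>.
\<close>

lemma segment_point_geodesic_point:
  fixes x y :: "'a::hadamard_space"
  assumes t: "t \<in> {0..1}"
  shows "segment_point x t y (geodesic_point x t y)"
proof -
  define \<gamma> where "\<gamma> s = (SOME p. segment_point x s y p)" for s
  have \<gamma>: "segment_point x s y (\<gamma> s)" if "s \<in> {0..1}" for s
    unfolding \<gamma>_def using segment_point_exists[OF that] by (rule someI_ex)
  have dx: "dist x (\<gamma> s) = s * dist x y" and dy: "dist y (\<gamma> s) = (1 - s) * dist x y"
    and cn: "(dist z (\<gamma> s))\<^sup>2 \<le> (1 - s) * (dist z x)\<^sup>2 + s * (dist z y)\<^sup>2 - s * (1 - s) * (dist x y)\<^sup>2"
    if "s \<in> {0..1}" for s z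
    using \<gamma>[OF that] unfolding segment_point_def by auto
  have "minimal_geodesic \<gamma> x y"
    unfolding minimal_geodesic_def
  proof (intro conjI ballI)
    show "\<gamma> 0 = x" "\<gamma> 1 = y" using dx[of 0] dy[of 1] by simp_all
    fix s t :: real assume s: "s \<in> {0..1}" and t: "t \<in> {0..1}"
    have "(dist (\<gamma> s) (\<gamma> t))\<^sup>2 \<le> (\<bar>t - s\<bar> * dist x y)\<^sup>2"
      using cn[OF t, of "\<gamma> s"] dx[OF s] dy[OF s]
      by (simp add: dist_commute power2_eq_square algebra_simps)
    then have "dist (\<gamma> s) (\<gamma> t) \<le> \<bar>t - s\<bar> * dist x y"
      by (auto intro: power2_le_imp_le)
    moreover have "\<bar>t - s\<bar> * dist x y = \<bar>dist x (\<gamma> t) - dist x (\<gamma> s)\<bar>"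
      by (simp add: dx[OF s] dx[OF t] abs_mult flip: left_diff_distrib)
    moreover have "\<bar>dist x (\<gamma> t) - dist x (\<gamma> s)\<bar> \<le> dist (\<gamma> s) (\<gamma> t)"
      using abs_dist_diff_le[of "\<gamma> t" x "\<gamma> s"]
      by (simp add: dist_commute[of "\<gamma> t" x] dist_commute[of "\<gamma> t" "\<gamma> s"])
    ultimately show "dist (\<gamma> s) (\<gamma> t) = \<bar>t - s\<bar> * dist x y" by linarith
  qed
  then have witness: "\<exists>\<eta>. minimal_geodesic \<eta> x y \<and> \<eta> t = \<gamma> t" by blast
  have unique: "\<eta> t = \<gamma> t" if "minimal_geodesic \<eta> x y" for \<eta>
  proof -
    have "dist (\<eta> t) x = t * dist x y" "dist (\<eta> t) y = (1 - t) * dist x y"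
      using that[unfolded minimal_geodesic_def] t
        that[unfolded minimal_geodesic_def, THEN conjunct2, THEN conjunct2, rule_format, of t 0]
        that[unfolded minimal_geodesic_def, THEN conjunct2, THEN conjunct2, rule_format, of t 1]
      by (simp_all add: abs_if)
    then have "(dist (\<eta> t) (\<gamma> t))\<^sup>2
        \<le> (1 - t) * (t * dist x y)\<^sup>2 + t * ((1 - t) * dist x y)\<^sup>2 - t * (1 - t) * (dist x y)\<^sup>2"
      using cn[OF t, of "\<eta> t"] by simp
    also have "\<dots> = 0" by (simp add: power2_eq_square algebra_simps)
    finally have "(dist (\<eta> t) (\<gamma> t))\<^sup>2 \<le> 0" .
    then show ?thesis by simp
  qed
  have "geodesic_point x t y = \<gamma> t"
    unfolding geodesic_point_def using witness by (rule the_equality) (use unique in blast)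
  then show ?thesis using \<gamma>[OF t] by simp
qed

text \<open>
  The two-point index set is \<open>bool\<close>, where \<open>True\<close> stands for the end point \<open>y\<close>.
\<close>

lemma geodesic_point_barycenter:
  fixes x y :: "'a::hadamard_space"
  assumes t: "t \<in> {0..1}"
  shows "barycenter UNIV (\<lambda>i. if i then t else 1 - t) (\<lambda>i. if i then y else x) (geodesic_point x t y)"
  unfolding barycenter_def
proof
  fix z
  let ?p = "geodesic_point x t y"
  have "dist x ?p = t * dist x y" "dist y ?p = (1 - t) * dist x y"
    "(dist z ?p)\<^sup>2 \<le> (1 - t) * (dist z x)\<^sup>2 + t * (dist z y)\<^sup>2 - t * (1 - t) * (dist x y)\<^sup>2"
    using segment_point_geodesic_point[OF t, of x y] unfolding segment_point_def by blast+
  moreover have "(1 - t) * (t * dist x y)\<^sup>2 + t * ((1 - t) * dist x y)\<^sup>2 = t * (1 - t) * (dist x y)\<^sup>2"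
    by (simp add: power2_eq_square algebra_simps)
  ultimately show "(\<Sum>i\<in>UNIV. (if i then t else 1 - t) * (dist (if i then y else x) ?p)\<^sup>2) + (dist z ?p)\<^sup>2
      \<le> (\<Sum>i\<in>UNIV. (if i then t else 1 - t) * (dist (if i then y else x) z)\<^sup>2)"
    by (simp add: UNIV_bool dist_commute[of _ z])
qed

section \<open>Means are Lipschitz in the data\<close>

text \<open>
  This is the Cauchy--Schwarz inequality of Berg and Nikolaev: in a Hilbert space, the difference of the
  squared distances is twice an inner product of \<open>y - x\<close> and \<open>u - v\<close>. The proof compares the
  quadrilateral with one point \<open>p\<close> on its diagonal from \<open>x\<close> to \<open>u\<close>: the CN inequality bounds the
  distances from \<open>p\<close> to \<open>y\<close> and \<open>v\<close>, and the other diagonal is at most their sum.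
\<close>

lemma quadruple_comparison:
  fixes x y u v :: "'a::hadamard_space"
  shows "(dist x u)\<^sup>2 + (dist y v)\<^sup>2 \<le> (dist y u)\<^sup>2 + (dist x v)\<^sup>2 + 2 * dist x y * dist u v"
proof (cases "x = y \<or> u = v")
  case True
  then show ?thesis by auto
next
  case False
  define a where "a = dist x y"
  define c where "c = dist u v"
  have pos: "0 < a" "0 < c" using False by (auto simp: a_def c_def)
  \<comment> \<open>any \<open>s\<close> strictly between 0 and 1 yields the error term \<open>(1 - s) / s * a\<^sup>2 + s / (1 - s) * c\<^sup>2\<close>;
    this choice minimizes it, with value \<open>2 * a * c\<close>\<close>
  define s where "s = a / (a + c)"
  have s: "0 < s" "s < 1" "1 - s = c / (a + c)" using pos by (auto simp: s_def field_simps)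
  obtain p where p: "\<And>z. (dist z p)\<^sup>2 \<le> (1 - s) * (dist z x)\<^sup>2 + s * (dist z u)\<^sup>2 - s * (1 - s) * (dist x u)\<^sup>2"
    using segment_point_exists[of s x u] s unfolding segment_point_def by auto
  let ?g = "dist y p" and ?h = "dist v p"
  have tri: "dist y v \<le> ?g + ?h" by (metis dist_commute dist_triangle)
  have "s * (1 - s) * (dist y v)\<^sup>2 \<le> s * (1 - s) * (?g + ?h)\<^sup>2"
    using s(1,2) tri by (intro mult_left_mono power_mono) auto
  also have "\<dots> = (1 - s) * ?g\<^sup>2 + s * ?h\<^sup>2 - ((1 - s) * ?g - s * ?h)\<^sup>2"
    by (simp add: power2_eq_square algebra_simps)
  also have "\<dots> \<le> (1 - s) * ?g\<^sup>2 + s * ?h\<^sup>2" by simp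
  also have "\<dots> \<le> (1 - s) * ((1 - s) * a\<^sup>2 + s * (dist y u)\<^sup>2 - s * (1 - s) * (dist x u)\<^sup>2)
      + s * ((1 - s) * (dist x v)\<^sup>2 + s * c\<^sup>2 - s * (1 - s) * (dist x u)\<^sup>2)"
    using p[of y] p[of v] s(1,2)
    by (intro add_mono mult_left_mono) (auto simp: a_def c_def dist_commute)
  also have "\<dots> = s * (1 - s) * ((dist y u)\<^sup>2 + (dist x v)\<^sup>2 - (dist x u)\<^sup>2) + ((1 - s)\<^sup>2 * a\<^sup>2 + s\<^sup>2 * c\<^sup>2)"
    by (simp add: power2_eq_square algebra_simps)
  also have "(1 - s)\<^sup>2 * a\<^sup>2 + s\<^sup>2 * c\<^sup>2 = s * (1 - s) * (2 * a * c)"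
    unfolding s(3) by (simp add: s_def power2_eq_square algebra_simps flip: add_divide_distrib)
  finally have "s * (1 - s) * (dist y v)\<^sup>2
      \<le> s * (1 - s) * ((dist y u)\<^sup>2 + (dist x v)\<^sup>2 - (dist x u)\<^sup>2 + 2 * a * c)"
    by (simp add: algebra_simps)
  then have "(dist y v)\<^sup>2 \<le> (dist y u)\<^sup>2 + (dist x v)\<^sup>2 - (dist x u)\<^sup>2 + 2 * a * c"
    using s(1,2) by simp
  then show ?thesis by (simp add: a_def c_def)
qed

lemma barycenter_contraction:
  fixes x y :: "'i \<Rightarrow> 'a::hadamard_space"
  assumes nonneg: "\<And>i. i \<in> I \<Longrightarrow> 0 \<le> w i"
    and b: "barycenter I w x b" and c: "barycenter I w y c"
  shows "dist b c \<le> (\<Sum>i\<in>I. w i * dist (x i) (y i))"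
proof -
  let ?D = "\<Sum>i\<in>I. w i * dist (x i) (y i)"
  have "2 * (dist b c)\<^sup>2 \<le> (\<Sum>i\<in>I. w i * (dist (x i) c)\<^sup>2) - (\<Sum>i\<in>I. w i * (dist (x i) b)\<^sup>2)
      + ((\<Sum>i\<in>I. w i * (dist (y i) b)\<^sup>2) - (\<Sum>i\<in>I. w i * (dist (y i) c)\<^sup>2))"
    using b[unfolded barycenter_def, rule_format, of c] c[unfolded barycenter_def, rule_format, of b]
    by (simp add: dist_commute[of c b])
  also have "\<dots> = (\<Sum>i\<in>I. w i * ((dist (x i) c)\<^sup>2 - (dist (x i) b)\<^sup>2 + (dist (y i) b)\<^sup>2 - (dist (y i) c)\<^sup>2))"
    by (simp add: sum.distrib sum_subtractf algebra_simps)
  also have "\<dots> \<le> (\<Sum>i\<in>I. w i * (2 * dist b c * dist (x i) (y i)))"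
  proof (intro sum_mono mult_left_mono nonneg)
    fix i
    show "(dist (x i) c)\<^sup>2 - (dist (x i) b)\<^sup>2 + (dist (y i) b)\<^sup>2 - (dist (y i) c)\<^sup>2
        \<le> 2 * dist b c * dist (x i) (y i)"
      using quadruple_comparison[of "x i" c "y i" b] by (simp add: dist_commute algebra_simps)
  qed
  also have "\<dots> = 2 * dist b c * ?D"
    by (simp add: sum_distrib_left algebra_simps)
  finally have "dist b c * dist b c \<le> dist b c * ?D" by (simp add: power2_eq_square)
  moreover have "0 \<le> ?D" using nonneg by (intro sum_nonneg) auto
  ultimately show ?thesis by (cases "dist b c = 0") auto
qed

lemma frechet_mean_contraction:
  fixes x y :: "nat \<Rightarrow> 'a::hadamard_space"
  assumes "1 \<le> n"
  shows "real n * dist (frechet_mean x n) (frechet_mean y n) \<le> (\<Sum>k=1..n. dist (x k) (y k))"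
  using barycenter_contraction[OF _ frechet_mean_barycenter frechet_mean_barycenter,
      OF _ assms assms, of x y] assms
  by (simp add: field_simps flip: sum_divide_distrib)

text \<open>
  By induction: one step is a contraction of two-point barycenters with weights \<open>1 - 1/(n+1)\<close> and
  \<open>1/(n+1)\<close>, which combine the average of \<open>n\<close> distances and the new distance into the average of \<open>n + 1\<close>
  distances.
\<close>

lemma inductive_mean_contraction:
  fixes x y :: "nat \<Rightarrow> 'a::hadamard_space"
  assumes "1 \<le> n"
  shows "real n * dist (inductive_mean x n) (inductive_mean y n) \<le> (\<Sum>k=1..n. dist (x k) (y k))"
  using assms
proof (induction n rule: dec_induct)
  case base
  show ?case by simp
next
  case (step n)
  then obtain k where k: "n = Suc k" by (cases n) auto
  define t where "t = 1 / real (Suc n)"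
  have t: "t \<in> {0..1}" "real (Suc n) * (1 - t) = real n" "real (Suc n) * t = 1"
    by (auto simp: t_def field_simps)
  have mean: "inductive_mean u (Suc n) = geodesic_point (inductive_mean u n) t (u (Suc n))"
    for u :: "nat \<Rightarrow> 'a"
    by (simp add: k t_def)
  have "dist (inductive_mean x (Suc n)) (inductive_mean y (Suc n))
      \<le> (1 - t) * dist (inductive_mean x n) (inductive_mean y n) + t * dist (x (Suc n)) (y (Suc n))"
    unfolding mean
    using barycenter_contraction[OF _ geodesic_point_barycenter geodesic_point_barycenter, OF _ t(1) t(1),
        of "inductive_mean x n" "x (Suc n)" "inductive_mean y n" "y (Suc n)"] t(1)
    by (simp add: UNIV_bool)
  then have "real (Suc n) * dist (inductive_mean x (Suc n)) (inductive_mean y (Suc n))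
      \<le> real (Suc n) * ((1 - t) * dist (inductive_mean x n) (inductive_mean y n) + t * dist (x (Suc n)) (y (Suc n)))"
    by (rule mult_left_mono) simp
  also have "\<dots> = real (Suc n) * (1 - t) * dist (inductive_mean x n) (inductive_mean y n)
      + real (Suc n) * t * dist (x (Suc n)) (y (Suc n))"
    by (simp only: distrib_left mult.assoc)
  also have "\<dots> \<le> (\<Sum>k=1..Suc n. dist (x k) (y k))"
    using step.IH unfolding t by simp
  finally show ?case .
qed

section \<open>Transfer of convergence in mean square\<close>

text \<open>
  The infimum over measurable majorants is the limit along a sequence of them, and the pointwise infimum of
  the sequence is again a measurable majorant. Having one optimal majorant lets the upper expectation
  inherit subadditivity from the additivity of the integral.
\<close>

lemma upper_expectation_attained:
  obtains g where "g \<in> borel_measurable M" and "\<And>\<omega>. \<omega> \<in> space M \<Longrightarrow> V \<omega> \<le> g \<omega>"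
    and "(\<integral>\<^sup>+\<omega>. g \<omega> \<partial>M) = upper_expectation M V"
proof -
  define G where "G = {g \<in> borel_measurable M. \<forall>\<omega>\<in>space M. V \<omega> \<le> g \<omega>}"
  define J where "J g = (\<integral>\<^sup>+\<omega>. g \<omega> \<partial>M)" for g
  have V: "upper_expectation M V = Inf (J ` G)"
    by (simp add: upper_expectation_def G_def J_def)
  have "(\<lambda>_. \<top>) \<in> G" by (simp add: G_def)
  then have "J ` G \<noteq> {}" by blast
  from ennreal_Inf_countable_INF[OF this] obtain e :: "nat \<Rightarrow> ennreal"
    where e: "range e \<subseteq> J ` G" and inf: "Inf (J ` G) = (INF i. e i)"
    by blast
  have "\<exists>g. g \<in> G \<and> e i = J g" for i using e by blast
  then obtain h where h: "\<And>i. h i \<in> G" "\<And>i. e i = J (h i)" by metis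
  define g where "g \<omega> = (INF i. h i \<omega>)" for \<omega>
  have meas: "g \<in> borel_measurable M"
    unfolding g_def using h(1) by (intro borel_measurable_INF) (simp_all add: G_def)
  have above: "V \<omega> \<le> g \<omega>" if "\<omega> \<in> space M" for \<omega>
    unfolding g_def using h(1) that by (intro INF_greatest) (simp add: G_def)
  have "J g \<le> J (h i)" for i
    unfolding J_def g_def by (intro nn_integral_mono INF_lower) simp
  then have "J g \<le> upper_expectation M V"
    unfolding V inf h(2) by (rule INF_greatest)
  moreover have "upper_expectation M V \<le> J g"
    unfolding V using meas above by (intro INF_lower) (simp add: G_def)
  ultimately have "(\<integral>\<^sup>+\<omega>. g \<omega> \<partial>M) = upper_expectation M V"
    unfolding J_def by (rule antisym)
  with meas above show thesis by (rule that)
qed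

lemma upper_expectation_le_linear_combination:
  fixes V W :: "'b \<Rightarrow> ennreal"
  assumes le: "\<And>\<omega>. \<omega> \<in> space M \<Longrightarrow> V \<omega> \<le> a * W \<omega> + c * (\<Sum>k\<in>K. U k \<omega>)"
  shows "upper_expectation M V \<le> a * upper_expectation M W + c * (\<Sum>k\<in>K. upper_expectation M (U k))"
proof -
  obtain g where g: "g \<in> borel_measurable M" "\<And>\<omega>. \<omega> \<in> space M \<Longrightarrow> W \<omega> \<le> g \<omega>"
    "(\<integral>\<^sup>+\<omega>. g \<omega> \<partial>M) = upper_expectation M W"
    using upper_expectation_attained by metis
  have "\<forall>k. \<exists>h. h \<in> borel_measurable M \<and> (\<forall>\<omega>\<in>space M. U k \<omega> \<le> h \<omega>) \<and>
      (\<integral>\<^sup>+\<omega>. h \<omega> \<partial>M) = upper_expectation M (U k)"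
    using upper_expectation_attained by metis
  then obtain h where h: "\<And>k. h k \<in> borel_measurable M" "\<And>k \<omega>. \<omega> \<in> space M \<Longrightarrow> U k \<omega> \<le> h k \<omega>"
    "\<And>k. (\<integral>\<^sup>+\<omega>. h k \<omega> \<partial>M) = upper_expectation M (U k)"
    by metis
  note [measurable] = g(1) h(1)
  have "V \<omega> \<le> a * g \<omega> + c * (\<Sum>k\<in>K. h k \<omega>)" if "\<omega> \<in> space M" for \<omega>
    using that by (intro order_trans[OF le] add_mono mult_left_mono sum_mono g h) auto
  then have "upper_expectation M V \<le> (\<integral>\<^sup>+\<omega>. a * g \<omega> + c * (\<Sum>k\<in>K. h k \<omega>) \<partial>M)"
    unfolding upper_expectation_def by (intro INF_lower) auto
  also have "\<dots> = a * upper_expectation M W + c * (\<Sum>k\<in>K. upper_expectation M (U k))"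
    by (simp add: nn_integral_add nn_integral_cmult nn_integral_sum g(3) h(3))
  finally show ?thesis .
qed

text \<open>
  The factor is the number of summands on the left and not the size of the larger set \<open>K\<close>. This is what lets
  few replacements have little effect.
\<close>

lemma sq_sum_sparse_le:
  fixes a :: "'i \<Rightarrow> real"
  assumes "finite K" and "J \<subseteq> K"
  shows "(\<Sum>k\<in>J. a k)\<^sup>2 \<le> real (card J) * (\<Sum>k\<in>K. (a k)\<^sup>2)"
proof -
  have "(\<Sum>k\<in>J. a k)\<^sup>2 \<le> real (card J) * (\<Sum>k\<in>J. (a k)\<^sup>2)"
    using Cauchy_Schwarz_ineq_sum[of "\<lambda>_. 1" a J] by simp
  also have "\<dots> \<le> real (card J) * (\<Sum>k\<in>K. (a k)\<^sup>2)"
    using assms by (intro mult_left_mono sum_mono2) auto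
  finally show ?thesis .
qed

lemma tendsto_L2_contractive_mean:
  fixes T :: "(nat \<Rightarrow> 'a::hadamard_space) \<Rightarrow> nat \<Rightarrow> 'a"
  assumes T: "\<And>n x y. 1 \<le> n \<Longrightarrow> real n * dist (T x n) (T y n) \<le> (\<Sum>k=1..n. dist (x k) (y k))"
    and f: "\<And>n \<omega>. 1 \<le> n \<Longrightarrow> \<omega> \<in> space M \<Longrightarrow> f n \<omega> \<in> selectors n (r n)"
    and Z: "\<And>n k \<omega>. 1 \<le> k \<Longrightarrow> k \<le> n \<Longrightarrow> \<omega> \<in> space M \<Longrightarrow>
           Z n k \<omega> = (if f n \<omega> k = 0 then X k \<omega> else Y k \<omega>)"
    and small: "(\<lambda>n. ennreal (real (r n) / (real n)\<^sup>2) *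
               (\<Sum>k=1..n. upper_expectation M (\<lambda>\<omega>. ennreal ((dist (X k \<omega>) (Y k \<omega>))\<^sup>2))))
           \<longlonglongrightarrow> 0"
    and X: "tendsto_L2 M (\<lambda>n \<omega>. T (\<lambda>k. X k \<omega>) n) (\<lambda>_. \<mu>)"
  shows "tendsto_L2 M (\<lambda>n \<omega>. T (\<lambda>k. Z n k \<omega>) n) (\<lambda>_. \<mu>)"
proof -
  let ?c = "\<lambda>n. real (r n) / (real n)\<^sup>2"
  let ?D = "\<lambda>n. \<Sum>k=1..n. upper_expectation M (\<lambda>\<omega>. ennreal ((dist (X k \<omega>) (Y k \<omega>))\<^sup>2))"
  let ?EX = "\<lambda>n. upper_expectation M (\<lambda>\<omega>. ennreal ((dist (T (\<lambda>k. X k \<omega>) n) \<mu>)\<^sup>2))"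
  let ?EZ = "\<lambda>n. upper_expectation M (\<lambda>\<omega>. ennreal ((dist (T (\<lambda>k. Z n k \<omega>) n) \<mu>)\<^sup>2))"
  have pointwise: "(dist (T (\<lambda>k. Z n k \<omega>) n) \<mu>)\<^sup>2
      \<le> 2 * (dist (T (\<lambda>k. X k \<omega>) n) \<mu>)\<^sup>2 + (2 * ?c n) * (\<Sum>k=1..n. (dist (X k \<omega>) (Y k \<omega>))\<^sup>2)"
    if n: "1 \<le> n" and \<omega>: "\<omega> \<in> space M" for n \<omega>
  proof -
    define J where "J = {k \<in> {1..n}. f n \<omega> k = 1}"
    have f01: "f n \<omega> k \<in> {0, 1}" if "k \<in> {1..n}" for k
      using f[OF n \<omega>] that unfolding selectors_def by auto
    have card: "card J = r n"
      using f[OF n \<omega>] unfolding selectors_def J_def by simp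
    let ?p = "dist (T (\<lambda>k. X k \<omega>) n) \<mu>" and ?q = "dist (T (\<lambda>k. X k \<omega>) n) (T (\<lambda>k. Z n k \<omega>) n)"
    have "real n * ?q \<le> (\<Sum>k=1..n. dist (X k \<omega>) (Z n k \<omega>))" by (rule T[OF n])
    also have "\<dots> = (\<Sum>k=1..n. if f n \<omega> k = 1 then dist (X k \<omega>) (Y k \<omega>) else 0)"
      using f01 by (intro sum.cong refl) (force simp: Z \<omega>)
    also have "\<dots> = (\<Sum>k\<in>J. dist (X k \<omega>) (Y k \<omega>))"
      unfolding J_def by (rule sum.inter_filter[symmetric]) simp
    finally have "(real n * ?q)\<^sup>2 \<le> (\<Sum>k\<in>J. dist (X k \<omega>) (Y k \<omega>))\<^sup>2"
      by (rule power_mono) simp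
    also have "\<dots> \<le> real (r n) * (\<Sum>k=1..n. (dist (X k \<omega>) (Y k \<omega>))\<^sup>2)"
      unfolding card[symmetric] by (rule sq_sum_sparse_le) (auto simp: J_def)
    finally have q: "?q\<^sup>2 \<le> ?c n * (\<Sum>k=1..n. (dist (X k \<omega>) (Y k \<omega>))\<^sup>2)"
      using n by (simp add: power_mult_distrib field_simps)
    have "dist (T (\<lambda>k. Z n k \<omega>) n) \<mu> \<le> ?q + ?p"
      by (metis dist_commute dist_triangle)
    then have "(dist (T (\<lambda>k. Z n k \<omega>) n) \<mu>)\<^sup>2 \<le> (?q + ?p)\<^sup>2" by (rule power_mono) simp
    also have "\<dots> \<le> 2 * ?p\<^sup>2 + 2 * ?q\<^sup>2"
      using sum_squares_bound[of ?q ?p] by (simp add: power2_sum)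
    finally show ?thesis using q by linarith
  qed
  have bound: "?EZ n \<le> 2 * ?EX n + 2 * (ennreal (?c n) * ?D n)" if n: "1 \<le> n" for n
  proof -
    have "?EZ n \<le> ennreal 2 * ?EX n + ennreal (2 * ?c n) * ?D n"
    proof (rule upper_expectation_le_linear_combination)
      fix \<omega> assume "\<omega> \<in> space M"
      from ennreal_leI[OF pointwise[OF n this]]
      show "ennreal ((dist (T (\<lambda>k. Z n k \<omega>) n) \<mu>)\<^sup>2)
          \<le> ennreal 2 * ennreal ((dist (T (\<lambda>k. X k \<omega>) n) \<mu>)\<^sup>2)
            + ennreal (2 * ?c n) * (\<Sum>k=1..n. ennreal ((dist (X k \<omega>) (Y k \<omega>))\<^sup>2))"
        by (simp only: ennreal_plus ennreal_mult sum_ennreal zero_le_power2 sum_nonneg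
            mult_nonneg_nonneg zero_le_numeral divide_nonneg_nonneg of_nat_0_le_iff)
    qed
    moreover have "ennreal (2 * ?c n) = 2 * ennreal (?c n)"
      using ennreal_mult[of 2 "?c n"] by simp
    ultimately show ?thesis by (simp only: ennreal_numeral mult.assoc)
  qed
  have upper: "(\<lambda>n. 2 * ?EX n + 2 * (ennreal (?c n) * ?D n)) \<longlonglongrightarrow> 0"
    using tendsto_add[OF ennreal_tendsto_cmult[OF _ X[unfolded tendsto_L2_def], of 2]
        ennreal_tendsto_cmult[OF _ small, of 2]] by simp
  have "?EZ \<longlonglongrightarrow> 0"
  proof (rule tendsto_sandwich[OF _ _ tendsto_const upper])
    show "\<forall>\<^sub>F n in sequentially. 0 \<le> ?EZ n" by simp
    show "\<forall>\<^sub>F n in sequentially. ?EZ n \<le> 2 * ?EX n + 2 * (ennreal (?c n) * ?D n)"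
      using bound by (rule eventually_sequentiallyI)
  qed
  then show ?thesis unfolding tendsto_L2_def .
qed

theorem proposition3:
  fixes M :: "'b measure"
    and \<mu> :: "'a::hadamard_space"
    and X Y :: "nat \<Rightarrow> 'b \<Rightarrow> 'a"
    and r :: "nat \<Rightarrow> nat"
    and f :: "nat \<Rightarrow> 'b \<Rightarrow> nat \<Rightarrow> nat"
    and Z :: "nat \<Rightarrow> nat \<Rightarrow> 'b \<Rightarrow> 'a"
  assumes "prob_space M"
    and "\<And>k. 1 \<le> k \<Longrightarrow> in_L2 M (X k)"
    and "\<And>k. 1 \<le> k \<Longrightarrow> in_L2 M (Y k)"
    and "\<And>n. 1 \<le> n \<Longrightarrow> 1 \<le> r n \<and> r n \<le> n"
    and "\<And>n. 1 \<le> n \<Longrightarrow> f n \<in> M \<rightarrow>\<^sub>M count_space (selectors n (r n))"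
    and "\<And>n. 1 \<le> n \<Longrightarrow>
           distr M (count_space (selectors n (r n))) (f n) = uniform_count_measure (selectors n (r n))"
    and "\<And>n. 1 \<le> n \<Longrightarrow>
           prob_space.indep_set M
             (sets (vimage_algebra (space M) (f n) (count_space (selectors n (r n)))))
             (sets (vimage_algebra (space M) (\<lambda>\<omega>. (\<lambda>k\<in>{1..n}. X k \<omega>, \<lambda>k\<in>{1..n}. Y k \<omega>))
                ((\<Pi>\<^sub>M k\<in>{1..n}. borel) \<Otimes>\<^sub>M (\<Pi>\<^sub>M k\<in>{1..n}. borel))))"
    and "\<And>n k \<omega>. 1 \<le> k \<Longrightarrow> k \<le> n \<Longrightarrow> \<omega> \<in> space M \<Longrightarrow>
           Z n k \<omega> = (if f n \<omega> k = 0 then X k \<omega> else Y k \<omega>)"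
    and "(\<lambda>n. ennreal (real (r n) / (real n)\<^sup>2) *
               (\<Sum>k=1..n. upper_expectation M (\<lambda>\<omega>. ennreal ((dist (X k \<omega>) (Y k \<omega>))\<^sup>2))))
           \<longlonglongrightarrow> 0"
  shows "(tendsto_L2 M (\<lambda>n \<omega>. inductive_mean (\<lambda>k. X k \<omega>) n) (\<lambda>_. \<mu>) \<longrightarrow>
          tendsto_L2 M (\<lambda>n \<omega>. inductive_mean (\<lambda>k. Z n k \<omega>) n) (\<lambda>_. \<mu>)) \<and>
         (tendsto_L2 M (\<lambda>n \<omega>. frechet_mean (\<lambda>k. X k \<omega>) n) (\<lambda>_. \<mu>) \<and>
          (\<exists>a. (\<lambda>n. prob_space.expectation M (\<lambda>\<omega>. MAX k\<in>{1..n}. (dist (X k \<omega>) a)\<^sup>2)) \<in> o(\<lambda>n. real n) \<and>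
               (\<lambda>n. prob_space.expectation M (\<lambda>\<omega>. MAX k\<in>{1..n}. (dist (Y k \<omega>) a)\<^sup>2)) \<in> o(\<lambda>n. real n)) \<longrightarrow>
          tendsto_L2 M (\<lambda>n \<omega>. frechet_mean (\<lambda>k. Z n k \<omega>) n) (\<lambda>_. \<mu>))"
proof (intro conjI impI; (elim conjE)?)
  have sel: "f n \<omega> \<in> selectors n (r n)" if "1 \<le> n" "\<omega> \<in> space M" for n \<omega>
    using measurable_space[OF assms(5)[OF that(1)] that(2)] by simp
  note transfer = tendsto_L2_contractive_mean[where f = f and r = r and X = X and Y = Y]
  show "tendsto_L2 M (\<lambda>n \<omega>. inductive_mean (\<lambda>k. Z n k \<omega>) n) (\<lambda>_. \<mu>)"
    if "tendsto_L2 M (\<lambda>n \<omega>. inductive_mean (\<lambda>k. X k \<omega>) n) (\<lambda>_. \<mu>)"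
    by (rule transfer) (fact inductive_mean_contraction sel assms(8,9) that)+
  show "tendsto_L2 M (\<lambda>n \<omega>. frechet_mean (\<lambda>k. Z n k \<omega>) n) (\<lambda>_. \<mu>)"
    if "tendsto_L2 M (\<lambda>n \<omega>. frechet_mean (\<lambda>k. X k \<omega>) n) (\<lambda>_. \<mu>)"
    by (rule transfer) (fact frechet_mean_contraction sel assms(8,9) that)+
qed

end
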